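(* Let $n\geq 1$. (i) For each $X\subseteq\{1,\dots,n\}$ the set $\mathrm{Nil}(X)$ is a maximal nilpotent subsemigroup of $\mathrm{K}_n$, with zero element $e_X$. The nilpotency class of $\mathrm{Nil}(X)$ is $|X|$ if $|X|>0$, and is $1$ if $|X|=0$. (ii) Every maximal nilpotent subsemigroup of $\mathrm{K}_n$ has the form $\mathrm{Nil}(X)$ for some $X\subseteq\{1,\dots,n\}$. (iii) $\mathrm{K}_n$ is the disjoint union of maximal nilpotent subsemigroups: $\mathrm{K}_n=\bigcup_{X\subseteq\{1,\dots,n\}}\mathrm{Nil}(X)$.
   Context: For a positive integer $n$, Kiselman's semigroup $\mathrm{K}_n$ is the monoid (with unit element $e$) given by the monoid presentation with generators $a_1,\dots,a_n$ and relations $a_i^2=a_i$ for $i=1,\dots,n$, and $a_ia_ja_i=a_ja_ia_j=a_ja_i$ for all $1\leq i<j\leq n$. The content $\mathfrak{c}(w)$ of an element $w\in\mathrm{K}_n$ is the set of all $i\in\{1,\dots,n\}$ such that $a_i$ appears in a word in the generators representing $w$; this does not depend on the chosen word. For $X\subseteq\{1,\dots,n\}$ put $\mathrm{Nil}(X)=\{w\in\mathrm{K}_n:\mathfrak{c}(w)=X\}$. Set $e_\varnothing=e$, and for $X=\{i_1,\dots,i_k\}$ with $i_1>i_2>\dots>i_k$, set $e_X=a_{i_1}a_{i_2}\cdots a_{i_k}\in\mathrm{K}_n$. A semigroup $S$ with zero element $0$ is nilpotent if $S^k=\{0\}$ for some $k\in\mathbb{N}=\{1,2,\dots\}$; the minimal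 such $k$ is its nilpotency class. A nilpotent subsemigroup of $\mathrm{K}_n$ is a subsemigroup that is nilpotent with respect to its own zero element (which need not be the zero of $\mathrm{K}_n$); maximal means maximal with respect to inclusion among these. *)

theory Defs
  imports "HOL-Algebra.Coset" "HOL-Library.Disjoint_Sets"
begin

text \<open>
  The generators are represented by the letters \<open>1, \<dots>, n\<close>, and the monoid with the given presentation
  is the quotient of the free monoid \<open>lists {1..n}\<close> by the least congruence containing the relations.
\<close>

inductive kis_rel :: "nat \<Rightarrow> nat list \<Rightarrow> nat list \<Rightarrow> bool" for n :: nat where
  idem: "i \<in> {1..n} \<Longrightarrow> kis_rel n [i, i] [i]"
| iji: "i \<in> {1..n} \<Longrightarrow> j \<in> {1..n} \<Longrightarrow> i < j \<Longrightarrow> kis_rel n [i, j, i] [j, i]"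
| jij: "i \<in> {1..n} \<Longrightarrow> j \<in> {1..n} \<Longrightarrow> i < j \<Longrightarrow> kis_rel n [j, i, j] [j, i]"

inductive kis_cong :: "nat \<Rightarrow> nat list \<Rightarrow> nat list \<Rightarrow> bool" for n :: nat where
  rel: "kis_rel n u v \<Longrightarrow> kis_cong n u v"
| refl: "w \<in> lists {1..n} \<Longrightarrow> kis_cong n w w"
| sym: "kis_cong n u v \<Longrightarrow> kis_cong n v u"
| trans: "kis_cong n u v \<Longrightarrow> kis_cong n v w \<Longrightarrow> kis_cong n u w"
| append: "kis_cong n u v \<Longrightarrow> kis_cong n u' v' \<Longrightarrow> kis_cong n (u @ u') (v @ v')"

definition kis_equiv :: "nat \<Rightarrow> (nat list \<times> nat list) set" where
  "kis_equiv n = {(u, v). kis_cong n u v}"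

definition kis_class :: "nat \<Rightarrow> nat list \<Rightarrow> nat list set" where
  "kis_class n w = kis_equiv n `` {w}"

definition Kiselman :: "nat \<Rightarrow> nat list set monoid" where
  "Kiselman n =
    \<lparr>carrier = lists {1..n} // kis_equiv n,
     mult = (\<lambda>A B. \<Union>u\<in>A. \<Union>v\<in>B. kis_class n (u @ v)),
     one = kis_class n []\<rparr>"

definition kis_gen :: "nat \<Rightarrow> nat \<Rightarrow> nat list set" where
  "kis_gen n i = kis_class n [i]"

text \<open>An element of \<^term>\<open>Kiselman n\<close> is the set of all words representing it.\<close>

definition content :: "nat list set \<Rightarrow> nat set" where
  "content x = {i. \<exists>w\<in>x. i \<in> set w}"

definition Nil_set :: "nat \<Rightarrow> nat set \<Rightarrow> nat list set set" where
  "Nil_set n X = {x \<in> carrier (Kiselman n). content x = X}"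

definition e_elem :: "nat \<Rightarrow> nat set \<Rightarrow> nat list set" where
  "e_elem n X =
    foldr (\<lambda>i x. kis_gen n i \<otimes>\<^bsub>Kiselman n\<^esub> x) (rev (sorted_list_of_set X)) \<one>\<^bsub>Kiselman n\<^esub>"

text \<open>A subsemigroup need not contain the unit element of \<open>M\<close>.\<close>

definition subsemigroup :: "('a, 'b) monoid_scheme \<Rightarrow> 'a set \<Rightarrow> bool" where
  "subsemigroup M S \<longleftrightarrow>
    S \<subseteq> carrier M \<and> S \<noteq> {} \<and> (\<forall>x\<in>S. \<forall>y\<in>S. x \<otimes>\<^bsub>M\<^esub> y \<in> S)"

definition is_zero_of :: "('a, 'b) monoid_scheme \<Rightarrow> 'a set \<Rightarrow> 'a \<Rightarrow> bool" where
  "is_zero_of M S z \<longleftrightarrow> z \<in> S \<and> (\<forall>x\<in>S. z \<otimes>\<^bsub>M\<^esub> x = z \<and> x \<otimes>\<^bsub>M\<^esub> z = z)"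

text \<open>The set of all products of \<open>k\<close> elements of \<open>S\<close>; only meant for \<open>k \<ge> 1\<close>.\<close>

definition set_power :: "('a, 'b) monoid_scheme \<Rightarrow> 'a set \<Rightarrow> nat \<Rightarrow> 'a set" where
  "set_power M S k = ((\<lambda>T. T <#>\<^bsub>M\<^esub> S) ^^ (k - 1)) S"

definition nilpotent_subsemigroup :: "('a, 'b) monoid_scheme \<Rightarrow> 'a set \<Rightarrow> bool" where
  "nilpotent_subsemigroup M S \<longleftrightarrow>
    subsemigroup M S \<and> (\<exists>z. is_zero_of M S z \<and> (\<exists>k\<ge>1. set_power M S k = {z}))"

definition nilpotency_class :: "('a, 'b) monoid_scheme \<Rightarrow> 'a set \<Rightarrow> nat" where
  "nilpotency_class M S =
    (LEAST k. k \<ge> 1 \<and> (\<exists>z. is_zero_of M S z \<and> set_power M S k = {z}))"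

definition maximal_nilpotent_subsemigroup :: "('a, 'b) monoid_scheme \<Rightarrow> 'a set \<Rightarrow> bool" where
  "maximal_nilpotent_subsemigroup M S \<longleftrightarrow>
    nilpotent_subsemigroup M S \<and>
    (\<forall>T. nilpotent_subsemigroup M T \<and> S \<subseteq> T \<longrightarrow> T = S)"

lemma kis_cong_in_lists:
  assumes "kis_cong n u v"
  shows "u \<in> lists {1..n} \<and> v \<in> lists {1..n}"
  using assms by induction (auto elim!: kis_rel.cases)

lemma kis_cong_set:
  assumes "kis_cong n u v"
  shows "set u = set v"
  using assms by induction (auto elim!: kis_rel.cases)

lemma equiv_kis_equiv: "equiv (lists {1..n}) (kis_equiv n)"
proof (rule equivI)
  show "kis_equiv n \<subseteq> lists {1..n} \<times> lists {1..n}"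
    using kis_cong_in_lists by (fastforce simp only: kis_equiv_def)
  show "refl_on (lists {1..n}) (kis_equiv n)"
    by (auto simp: refl_on_def kis_equiv_def intro: kis_cong.refl)
  show "sym (kis_equiv n)"
    by (auto simp: sym_def kis_equiv_def intro: kis_cong.sym)
  show "trans (kis_equiv n)"
    by (auto simp: trans_def kis_equiv_def intro: kis_cong.trans)
qed

lemma mem_kis_class [simp]: "v \<in> kis_class n u \<longleftrightarrow> kis_cong n u v"
  by (simp add: kis_class_def kis_equiv_def)

lemma kis_class_eq:
  assumes "kis_cong n u v"
  shows "kis_class n u = kis_class n v"
  using assms by (auto intro: kis_cong.trans kis_cong.trans[OF kis_cong.sym])

lemma carrier_Kiselman: "carrier (Kiselman n) = kis_class n ` lists {1..n}"
  by (auto simp: Kiselman_def quotient_def kis_class_def)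

lemma one_Kiselman: "\<one>\<^bsub>Kiselman n\<^esub> = kis_class n []"
  by (simp add: Kiselman_def)

lemma mult_kis_class:
  assumes "u \<in> lists {1..n}" "v \<in> lists {1..n}"
  shows "kis_class n u \<otimes>\<^bsub>Kiselman n\<^esub> kis_class n v = kis_class n (u @ v)"
proof -
  have "kis_class n (u' @ v') = kis_class n (u @ v)"
    if "u' \<in> kis_class n u" "v' \<in> kis_class n v" for u' v'
    using that by (intro kis_class_eq kis_cong.append) (auto intro: kis_cong.sym)
  moreover have "u \<in> kis_class n u" "v \<in> kis_class n v"
    using assms by (auto intro: kis_cong.refl)
  ultimately have "(\<Union>u'\<in>kis_class n u. \<Union>v'\<in>kis_class n v. kis_class n (u' @ v'))
      = kis_class n (u @ v)"
    by blast
  then show ?thesis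
    by (simp add: Kiselman_def)
qed

lemma monoid_Kiselman: "monoid (Kiselman n)"
proof (rule monoidI)
  show "\<one>\<^bsub>Kiselman n\<^esub> \<in> carrier (Kiselman n)"
    unfolding carrier_Kiselman one_Kiselman by (rule imageI) simp
next
  fix x y assume "x \<in> carrier (Kiselman n)" "y \<in> carrier (Kiselman n)"
  then obtain u v where uv: "u \<in> lists {1..n}" "v \<in> lists {1..n}"
    and xy: "x = kis_class n u" "y = kis_class n v"
    unfolding carrier_Kiselman by blast
  have "u @ v \<in> lists {1..n}" using uv by simp
  then show "x \<otimes>\<^bsub>Kiselman n\<^esub> y \<in> carrier (Kiselman n)"
    unfolding xy mult_kis_class[OF uv] carrier_Kiselman by (rule imageI)
next
  fix x y z
  assume "x \<in> carrier (Kiselman n)" "y \<in> carrier (Kiselman n)" "z \<in> carrier (Kiselman n)"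
  then obtain u v w where uvw: "u \<in> lists {1..n}" "v \<in> lists {1..n}" "w \<in> lists {1..n}"
    and xyz: "x = kis_class n u" "y = kis_class n v" "z = kis_class n w"
    unfolding carrier_Kiselman by blast
  have "u @ v \<in> lists {1..n}" "v @ w \<in> lists {1..n}" using uvw by simp_all
  then show "x \<otimes>\<^bsub>Kiselman n\<^esub> y \<otimes>\<^bsub>Kiselman n\<^esub> z = x \<otimes>\<^bsub>Kiselman n\<^esub> (y \<otimes>\<^bsub>Kiselman n\<^esub> z)"
    using uvw unfolding xyz by (simp only: mult_kis_class append_assoc)
next
  fix x assume "x \<in> carrier (Kiselman n)"
  then obtain u where u: "u \<in> lists {1..n}" and x: "x = kis_class n u"
    unfolding carrier_Kiselman by blast
  have "[] \<in> lists {1..n}" by simp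
  with u show "\<one>\<^bsub>Kiselman n\<^esub> \<otimes>\<^bsub>Kiselman n\<^esub> x = x" "x \<otimes>\<^bsub>Kiselman n\<^esub> \<one>\<^bsub>Kiselman n\<^esub> = x"
    unfolding x one_Kiselman by (simp_all only: mult_kis_class append.simps append_Nil2)
qed

lemma content_kis_class:
  assumes "w \<in> lists {1..n}"
  shows "content (kis_class n w) = set w"
  using assms kis_cong_set by (fastforce simp: content_def intro: kis_cong.refl)

end

theory Submission
  imports Defs
begin

text \<open>
  Behind an occurrence of the largest letter, all its further occurrences can be deleted. Applied to a
  product of \<open>|X|\<close> words with content \<open>X\<close>, this reduces to \<open>X - {Max X}\<close> and the remaining \<open>|X| - 1\<close>
  factors, so induction on \<open>X\<close> shows that the product is \<open>e\<^sub>X\<close>. Conversely,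
  the \<open>k\<close>-th power of the increasing product over \<open>X\<close> is not \<open>e\<^sub>X\<close> for \<open>k < |X|\<close>, as seen
  in the Catalan monoid: the monoid acts from the left on \<open>{0..|X|}\<close> with the \<open>p\<close>-th letter of \<open>X\<close> moving only \<open>p\<close>,
  to \<open>p + 1\<close>; the increasing product moves \<open>0\<close> by one step, and \<open>e\<^sub>X\<close> moves it to \<open>|X|\<close>.
  Finally, all elements of a nilpotent subsemigroup have a power equal to its zero, hence have the same content.
\<close>

section \<open>Deleting repeated letters modulo the congruence\<close>

lemmas [trans] = kis_cong.trans

lemma kis_cong_context:
  assumes "kis_cong n u v" "set p \<subseteq> {1..n}" "set s \<subseteq> {1..n}"
  shows "kis_cong n (p @ u @ s) (p @ v @ s)"
  using assms by (intro kis_cong.append kis_cong.refl) (auto simp: in_lists_conv_set)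

lemma kis_cong_idem: "i \<in> {1..n} \<Longrightarrow> kis_cong n [i, i] [i]"
  by (intro kis_cong.rel kis_rel.idem)

text \<open>Let \<open>i\<close> be the last letter of the middle word. The induction hypothesis,
  read backwards, inserts a \<open>j\<close> in front of \<open>i\<close>; the relation
  \<open>jij\<close> = \<open>ji\<close> deletes the final \<open>j\<close>, and the hypothesis
  removes the inserted one.\<close>

lemma kis_cong_drop_right:
  assumes "j \<in> {1..n}" "set u \<subseteq> {1..<j}"
  shows "kis_cong n (j # u @ [j]) (j # u)"
  using assms(2)
proof (induction u rule: rev_induct)
  case Nil
  show ?case using kis_cong_idem[OF assms(1)] by simp
next
  case (snoc i u)
  then have i: "i \<in> {1..n}" "i < j" and u: "set (j # u) \<subseteq> {1..n}" using assms(1) by auto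
  have IH: "kis_cong n (j # u @ [j]) (j # u)" using snoc by simp
  have "kis_cong n (j # (u @ [i]) @ [j]) (j # u @ [j, i, j])"
    using kis_cong_context[OF kis_cong.sym[OF IH], of "[]" "[i, j]"] i assms(1) by simp
  also have "kis_cong n (j # u @ [j, i, j]) (j # u @ [j, i])"
    using kis_cong_context[OF kis_cong.rel[OF kis_rel.jij[OF i(1) assms(1) i(2)]] u, of "[]"] by simp
  also have "kis_cong n (j # u @ [j, i]) (j # u @ [i])"
    using kis_cong_context[OF IH, of "[]" "[i]"] i by simp
  finally show ?case .
qed

text \<open>The mirror image of \<open>kis_cong_drop_right\<close>, now with \<open>iji\<close> =
  \<open>ji\<close>: between two copies of \<open>i\<close>, larger letters make the left copy
  redundant, just as smaller letters make the right one redundant.\<close>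

lemma kis_cong_drop_left:
  assumes "i \<in> {1..n}" "set u \<subseteq> {i<..n}"
  shows "kis_cong n (i # u @ [i]) (u @ [i])"
  using assms(2)
proof (induction u)
  case Nil
  show ?case using kis_cong_idem[OF assms(1)] by simp
next
  case (Cons j u)
  then have j: "j \<in> {1..n}" "i < j" and u: "set (u @ [i]) \<subseteq> {1..n}" using assms(1) by auto
  have IH: "kis_cong n (i # u @ [i]) (u @ [i])" using Cons by simp
  have "kis_cong n (i # (j # u) @ [i]) ([i, j, i] @ u @ [i])"
    using kis_cong_context[OF kis_cong.sym[OF IH], of "[i, j]" "[]"] j assms(1) by simp
  also have "kis_cong n ([i, j, i] @ u @ [i]) ([j, i] @ u @ [i])"
    using kis_cong_context[OF kis_cong.rel[OF kis_rel.iji[OF assms(1) j]] _ u, of "[]"] by simp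
  also have "kis_cong n ([j, i] @ u @ [i]) ((j # u) @ [i])"
    using kis_cong_context[OF IH, of "[j]" "[]"] j by simp
  finally show ?case .
qed

text \<open>Scanning \<open>v\<close> from left to right, each new \<open>j\<close> meets a prefix
  already cleared of \<open>j\<close>. All letters between it and the leading \<open>j\<close> are
  then smaller, so \<open>kis_cong_drop_right\<close> deletes it.\<close>

lemma kis_cong_filter_max:
  assumes "j \<in> {1..n}" "set v \<subseteq> {1..j}"
  shows "kis_cong n (j # v) (j # filter (\<lambda>i. i \<noteq> j) v)"
  using assms(2)
proof (induction v rule: rev_induct)
  case Nil
  show ?case using assms(1) by (auto intro: kis_cong.refl)
next
  case (snoc i v)
  let ?w = "filter (\<lambda>i. i \<noteq> j) v"
  have "kis_cong n (j # v @ [i]) (j # ?w @ [i])"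
    using kis_cong_context[of n "j # v" "j # ?w" "[]" "[i]"] snoc assms(1) by auto
  moreover have "kis_cong n (j # ?w @ [j]) (j # ?w)"
    using snoc.prems assms(1) by (intro kis_cong_drop_right) fastforce+
  ultimately show ?case
    by (auto intro: kis_cong.trans)
qed

section \<open>Descending words and their absorption of letters\<close>

abbreviation desc :: "nat set \<Rightarrow> nat list" where
  "desc X \<equiv> rev (sorted_list_of_set X)"

lemma set_desc: "X \<subseteq> {1..n} \<Longrightarrow> set (desc X) = X"
  by (simp add: finite_subset[OF _ finite_atLeastAtMost])

lemma desc_insert_max:
  assumes "finite X" "\<forall>x\<in>X. x < m"
  shows "desc (insert m X) = m # desc X"
proof -
  have "m \<notin> X" using assms(2) by auto
  then have "sorted_list_of_set (insert m X) = sorted_list_of_set X @ [m]"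
    using assms by (subst sorted_list_of_set_unique[symmetric])
      (auto simp: sorted_wrt_append)
  then show ?thesis by simp
qed

lemma desc_split:
  assumes X: "X \<subseteq> {1..n}" and "i \<in> X"
  obtains p s where "desc X = p @ i # s" "set p \<subseteq> {i<..n}" "set s \<subseteq> {1..<i}"
proof -
  have "i \<in> set (desc X)" using set_desc[OF X] \<open>i \<in> X\<close> by simp
  then obtain p s where ps: "desc X = p @ i # s" by (meson split_list)
  have "sorted_wrt (>) (desc X)"
    using strict_sorted_list_of_set by (simp add: sorted_wrt_rev)
  moreover have "set (p @ i # s) \<subseteq> {1..n}" using X set_desc[OF X] ps by metis
  ultimately have "set p \<subseteq> {i<..n}" "set s \<subseteq> {1..<i}"
    by (auto simp: ps sorted_wrt_append)
  with ps that show ?thesis by blast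
qed

text \<open>In \<open>desc X\<close> only letters larger than \<open>i\<close> precede
  \<open>i\<close>, so a copy of \<open>i\<close> put in front is deleted by
  \<open>kis_cong_drop_left\<close>.\<close>

lemma kis_cong_desc_absorb_left:
  assumes X: "X \<subseteq> {1..n}" and "set u \<subseteq> X"
  shows "kis_cong n (u @ desc X) (desc X)"
  using assms(2)
proof (induction u)
  case Nil
  show ?case using X set_desc[OF X] by (auto intro!: kis_cong.refl)
next
  case (Cons i u)
  then have i: "i \<in> X" by simp
  with X have i': "i \<in> {1..n}" by blast
  obtain p s where ps: "desc X = p @ i # s" "set p \<subseteq> {i<..n}" "set s \<subseteq> {1..<i}"
    using desc_split[OF X i] .
  have "kis_cong n ((i # u) @ desc X) (i # desc X)"
    using kis_cong_context[of n "u @ desc X" "desc X" "[i]" "[]"] Cons i' by simp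
  also have "kis_cong n (i # desc X) (desc X)"
    using kis_cong_context[OF kis_cong_drop_left[OF i' ps(2)], of "[]" s] ps(3) i'
    by (fastforce simp: ps(1))
  finally show ?case .
qed

text \<open>Only smaller letters follow \<open>i\<close> in \<open>desc X\<close>, so here
  \<open>kis_cong_drop_right\<close> deletes the appended copy.\<close>

lemma kis_cong_desc_absorb_right:
  assumes X: "X \<subseteq> {1..n}" and "set u \<subseteq> X"
  shows "kis_cong n (desc X @ u) (desc X)"
  using assms(2)
proof (induction u rule: rev_induct)
  case Nil
  show ?case using X set_desc[OF X] by (auto intro!: kis_cong.refl)
next
  case (snoc i u)
  then have i: "i \<in> X" by simp
  with X have i': "i \<in> {1..n}" by blast
  obtain p s where ps: "desc X = p @ i # s" "set p \<subseteq> {i<..n}" "set s \<subseteq> {1..<i}"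
    using desc_split[OF X i] .
  have "kis_cong n (desc X @ u @ [i]) (desc X @ [i])"
    using kis_cong_context[of n "desc X @ u" "desc X" "[]" "[i]"] snoc i' by simp
  also have "kis_cong n (desc X @ [i]) (desc X)"
    using kis_cong_context[OF kis_cong_drop_right[OF i' ps(3)], of p "[]"] ps(2) i'
    by (fastforce simp: ps(1))
  finally show ?case .
qed

lemma kis_cong_concat_desc:
  assumes "X \<subseteq> {1..n}" "length ws = card X" "\<forall>w\<in>set ws. set w = X"
  shows "kis_cong n (concat ws) (desc X)"
proof -
  have "finite X" using assms(1) finite_subset by blast
  then show ?thesis using assms
  proof (induction X arbitrary: ws rule: finite_linorder_max_induct)
    case empty
    then show ?case by (auto intro: kis_cong.refl)
  next
    case (insert m X)
    then have m: "m \<in> {1..n}" and X: "X \<subseteq> {1..n}" and mX: "m \<notin> X" by auto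
    then have "length ws = Suc (card X)" using insert by simp
    then obtain w ws' where ws: "ws = w # ws'" and len: "length ws' = card X"
      by (metis length_Suc_conv)
    have w: "set w = insert m X" and ws': "\<forall>v\<in>set ws'. set v = insert m X"
      using insert.prems ws by auto
    \<comment> \<open>Splitting at the first \<open>m\<close> keeps \<open>p\<close> free of
      \<open>m\<close>; \<open>p\<close> stays in front until \<open>desc (insert m X)\<close>
      absorbs it at the end.\<close>
    then obtain p s where ps: "w = p @ m # s" "m \<notin> set p"
      by (metis insertI1 split_list_first)
    let ?f = "filter (\<lambda>i. i \<noteq> m)"
    have p: "set p \<subseteq> X" and s: "set s \<subseteq> insert m X" using ps w by auto
    have le: "insert m X \<subseteq> {1..m}" using insert.hyps X m by force
    have "kis_cong n (m # s @ concat ws') (m # ?f (s @ concat ws'))"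
    proof (rule kis_cong_filter_max[OF m])
      show "set (s @ concat ws') \<subseteq> {1..m}" using s ws' le by auto
    qed
    then have "kis_cong n (concat ws) ((p @ [m] @ ?f s) @ concat (map ?f ws'))"
      using kis_cong_context[of n _ _ p "[]"] p X
      by (fastforce simp: ws ps(1) filter_concat)
    \<comment> \<open>Without \<open>m\<close> each remaining word has content exactly
      \<open>X\<close>, and \<open>card X\<close> words are left, as the induction hypothesis
      demands.\<close>
    also have "kis_cong n (concat (map ?f ws')) (desc X)"
      using insert.IH[OF X, of "map ?f ws'"] len ws' mX by auto
    then have "kis_cong n ((p @ [m] @ ?f s) @ concat (map ?f ws')) ((p @ [m] @ ?f s) @ desc X)"
      using kis_cong_context[of n _ _ "p @ [m] @ ?f s" "[]"] p s X m by fastforce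
    \<comment> \<open>The letters of \<open>s\<close> stand between \<open>m\<close> and
      \<open>desc X\<close>; once they are absorbed, \<open>m\<close> and \<open>desc X\<close> join
      to \<open>desc (insert m X)\<close>.\<close>
    also have "kis_cong n (?f s @ desc X) (desc X)"
      using s by (intro kis_cong_desc_absorb_left[OF X]) auto
    then have "kis_cong n ((p @ [m] @ ?f s) @ desc X) (p @ desc (insert m X))"
      using kis_cong_context[of n "?f s @ desc X" "desc X" "p @ [m]" "[]"] p X m
      by (simp add: desc_insert_max[OF insert.hyps(1,2)] subset_trans)
    also have "kis_cong n (p @ desc (insert m X)) (desc (insert m X))"
      using p by (intro kis_cong_desc_absorb_left[OF insert.prems(1)]) auto
    finally show ?case .
  qed
qed

section \<open>The action on positions that separates words\<close>

definition shift :: "nat list \<Rightarrow> nat \<Rightarrow> nat \<Rightarrow> nat" where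
  "shift xs i p = (if p < length xs \<and> xs ! p = i then Suc p else p)"

text \<open>As \<open>foldr\<close> lets the rightmost letter act first, words act from the left.
  For i < j, the extra letter in \<open>iji\<close> or \<open>jij\<close> could change the result
  only if, in \<open>xs\<close>, \<open>i\<close> came directly after \<open>j\<close> or a letter
  recurred within two places. Strict increase excludes both, which is what \<open>step\<close>
  provides.\<close>

lemma foldr_shift_cong:
  assumes "sorted_wrt (<) xs" "kis_cong n u v"
  shows "foldr (shift xs) u = foldr (shift xs) v"
  using assms(2)
proof induction
  case (rel u v)
  have step: "Suc p < length xs \<Longrightarrow> xs ! p < xs ! Suc p"
    "Suc (Suc p) < length xs \<Longrightarrow> xs ! p < xs ! Suc (Suc p)" for p
    using assms(1) by (auto intro: sorted_wrt_nth_less)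
  show ?case using rel by cases (auto simp: fun_eq_iff shift_def dest: step)
qed auto

lemma foldr_shift_id: "p \<ge> length xs \<or> xs ! p \<notin> set us \<Longrightarrow> foldr (shift xs) us p = p"
  by (induction us) (auto simp: shift_def)

text \<open>The letters right of position \<open>p\<close> act first and fix \<open>p\<close>; then
  \<open>xs ! p\<close> moves it to \<open>Suc p\<close>; the letters left of it do not include the
  one that could move \<open>Suc p\<close>.\<close>

lemma foldr_shift_self:
  assumes "distinct xs" "p < length xs"
  shows "foldr (shift xs) xs p = Suc p"
proof -
  have xs: "xs = take p xs @ xs ! p # drop (Suc p) xs"
    using assms(2) by (rule id_take_nth_drop)
  have "xs ! p \<notin> set (drop (Suc p) xs)"
    using assms xs by (metis distinct.simps(2) distinct_append)
  then have 1: "foldr (shift xs) (drop (Suc p) xs) p = p"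
    by (simp add: foldr_shift_id)
  have "Suc p \<ge> length xs \<or> xs ! Suc p \<notin> set (take p xs)"
    using assms by (auto simp: in_set_conv_nth nth_eq_iff_index_eq)
  then have 2: "foldr (shift xs) (take p xs) (Suc p) = Suc p"
    by (rule foldr_shift_id)
  have "foldr (shift xs) xs p =
      foldr (shift xs) (take p xs) (shift xs (xs ! p) (foldr (shift xs) (drop (Suc p) xs) p))"
    by (subst (2) xs) simp
  then show ?thesis
    using 1 2 assms(2) by (simp add: shift_def)
qed

lemma foldr_shift_power:
  "distinct xs \<Longrightarrow> k \<le> length xs \<Longrightarrow> foldr (shift xs) (concat (replicate k xs)) 0 = k"
  by (induction k) (auto simp: foldr_shift_self)

text \<open>In the reversed word \<open>xs ! 0\<close> acts first, then \<open>xs ! 1\<close> and so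
  on, so each letter meets exactly the position it moves.\<close>

lemma foldr_shift_rev: "foldr (shift xs) (rev xs) 0 = length xs"
proof -
  have "foldr (shift xs) (rev (take k xs)) 0 = k" if "k \<le> length xs" for k
    using that by (induction k) (auto simp: take_Suc_conv_app_nth shift_def)
  from this[of "length xs"] show ?thesis by simp
qed

text \<open>The two words send 0 to \<open>k\<close> and to \<open>card X\<close>
  respectively.\<close>

lemma not_kis_cong_power_desc:
  assumes "X \<subseteq> {1..n}" "k < card X"
  shows "\<not> kis_cong n (concat (replicate k (sorted_list_of_set X))) (desc X)"
  using foldr_shift_cong[of "sorted_list_of_set X" n "concat (replicate k (sorted_list_of_set X))"]
    foldr_shift_power[of "sorted_list_of_set X" k] foldr_shift_rev[of "sorted_list_of_set X"] assms
  by (metis distinct_sorted_list_of_set length_sorted_list_of_set less_imp_le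
      less_irrefl strict_sorted_list_of_set)

section \<open>Powers, zero and nilpotency class of \<open>Nil_set n X\<close>\<close>

lemma set_power_1: "set_power M S (Suc 0) = S"
  by (simp add: set_power_def)

lemma set_power_Suc: "k \<ge> 1 \<Longrightarrow> set_power M S (Suc k) = set_power M S k <#>\<^bsub>M\<^esub> S"
  by (cases k) (simp_all add: set_power_def)

lemma is_zero_of_unique: "is_zero_of M S y \<Longrightarrow> is_zero_of M S z \<Longrightarrow> y = z"
  by (metis is_zero_of_def)

lemma e_elem_conv:
  assumes "X \<subseteq> {1..n}"
  shows "e_elem n X = kis_class n (desc X)"
proof -
  have "foldr (\<lambda>i x. kis_gen n i \<otimes>\<^bsub>Kiselman n\<^esub> x) w \<one>\<^bsub>Kiselman n\<^esub> = kis_class n w"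
    if "w \<in> lists {1..n}" for w
    using that
  proof induction
    case (Cons i w)
    then show ?case
      using mult_kis_class[of "[i]" n w] by (simp add: kis_gen_def)
  qed (simp add: one_Kiselman)
  moreover have "desc X \<in> lists {1..n}" using set_desc[OF assms] assms by blast
  ultimately show ?thesis unfolding e_elem_def by blast
qed

lemma Nil_set_conv:
  assumes "X \<subseteq> {1..n}"
  shows "Nil_set n X = kis_class n ` {w. set w = X}"
proof -
  have "Nil_set n X = kis_class n ` {w \<in> lists {1..n}. set w = X}"
    unfolding Nil_set_def carrier_Kiselman using content_kis_class by blast
  also have "{w \<in> lists {1..n}. set w = X} = {w. set w = X}"
    using assms by auto
  finally show ?thesis .
qed

text \<open>Translates products of \<open>k\<close> elements into concatenations of \<open>k\<close>
  words, so that both bounds on the class become statements about words.\<close>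

lemma set_power_Nil_set:
  assumes X: "X \<subseteq> {1..n}" and "k \<ge> 1"
  shows "set_power (Kiselman n) (Nil_set n X) k =
    (\<lambda>ws. kis_class n (concat ws)) ` {ws. length ws = k \<and> (\<forall>w\<in>set ws. set w = X)}"
    (is "_ = ?f ` ?W k")
  using assms(2)
proof (induction k rule: nat_induct_at_least)
  case base
  have "?W 1 = (\<lambda>w. [w]) ` {w. set w = X}"
    by (auto simp: length_Suc_conv)
  then show ?case
    by (simp add: set_power_1 Nil_set_conv[OF X] image_image)
next
  case (Suc k)
  \<comment> \<open>The new word goes at the end because \<open>set_power\<close> multiplies by the
    new factor on the right.\<close>
  have W: "?W (Suc k) = (\<lambda>(ws, w). ws @ [w]) ` (?W k \<times> {w. set w = X})"
    by (auto simp: length_Suc_conv_rev image_iff)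
  have mult: "?f ws \<otimes>\<^bsub>Kiselman n\<^esub> kis_class n w = ?f (ws @ [w])"
    if "ws \<in> ?W k" "set w = X" for ws w
  proof -
    have "set (concat ws) \<subseteq> X" using that by auto
    then have "concat ws \<in> lists {1..n}" "w \<in> lists {1..n}" using that(2) X by blast+
    then show ?thesis by (simp only: mult_kis_class concat_append concat.simps append_Nil2)
  qed
  have "set_power (Kiselman n) (Nil_set n X) (Suc k) =
      ?f ` ?W k <#>\<^bsub>Kiselman n\<^esub> kis_class n ` {w. set w = X}"
    using Suc by (simp only: set_power_Suc Nil_set_conv[OF X])
  also have "\<dots> = (\<lambda>(ws, w). ?f ws \<otimes>\<^bsub>Kiselman n\<^esub> kis_class n w) ` (?W k \<times> {w. set w = X})"
    unfolding set_mult_def by blast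
  also have "\<dots> = (\<lambda>(ws, w). ?f (ws @ [w])) ` (?W k \<times> {w. set w = X})"
    using mult by (intro image_cong) auto
  also have "\<dots> = ?f ` ?W (Suc k)"
    unfolding W image_image by (simp only: case_prod_unfold)
  finally show ?case .
qed

lemma is_zero_of_Nil_set:
  assumes X: "X \<subseteq> {1..n}"
  shows "is_zero_of (Kiselman n) (Nil_set n X) (e_elem n X)"
proof -
  have "kis_class n (desc X) \<otimes>\<^bsub>Kiselman n\<^esub> kis_class n w = kis_class n (desc X) \<and>
      kis_class n w \<otimes>\<^bsub>Kiselman n\<^esub> kis_class n (desc X) = kis_class n (desc X)"
    if w: "set w = X" for w
  proof -
    have l: "w \<in> lists {1..n}" "desc X \<in> lists {1..n}"
      using w X set_desc[OF X] by auto
    show ?thesis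
      unfolding mult_kis_class[OF l] mult_kis_class[OF l(2,1)]
      using kis_cong_desc_absorb_left[OF X] kis_cong_desc_absorb_right[OF X] w
      by (intro conjI kis_class_eq) auto
  qed
  then show ?thesis
    unfolding is_zero_of_def e_elem_conv[OF X] Nil_set_conv[OF X]
    using set_desc[OF X] by blast
qed

lemma set_power_Nil_set_card:
  assumes X: "X \<subseteq> {1..n}" and "card X \<ge> 1"
  shows "set_power (Kiselman n) (Nil_set n X) (card X) = {e_elem n X}"
proof -
  have "kis_class n (concat ws) = e_elem n X"
    if "length ws = card X" "\<forall>w\<in>set ws. set w = X" for ws
    unfolding e_elem_conv[OF X] by (intro kis_class_eq kis_cong_concat_desc X that)
  moreover have "replicate (card X) (desc X) \<in> {ws. length ws = card X \<and> (\<forall>w\<in>set ws. set w = X)}"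
    using set_desc[OF X] by simp
  ultimately show ?thesis
    unfolding set_power_Nil_set[OF assms] by blast
qed

lemma Nil_set_empty: "Nil_set n {} = {e_elem n {}}"
  by (simp add: Nil_set_conv e_elem_conv)

lemma set_power_Nil_set_class:
  assumes X: "X \<subseteq> {1..n}"
  shows "set_power (Kiselman n) (Nil_set n X) (if card X > 0 then card X else 1) = {e_elem n X}"
proof (cases "card X > 0")
  case True
  then show ?thesis using set_power_Nil_set_card[OF X] by simp
next
  case False
  \<comment> \<open>Here \<open>Nil_set n X\<close> is the singleton of the unit, so already the
    first power is the zero; exponents start at 1.\<close>
  then have "X = {}" using X finite_subset by fastforce
  then show ?thesis by (simp add: Nil_set_empty set_power_1)
qed

lemma nilpotency_class_Nil_set:
  assumes X: "X \<subseteq> {1..n}"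
  shows "nilpotency_class (Kiselman n) (Nil_set n X) = (if card X > 0 then card X else 1)"
    (is "_ = ?c")
  unfolding nilpotency_class_def
proof (rule Least_equality)
  show "?c \<ge> 1 \<and> (\<exists>z. is_zero_of (Kiselman n) (Nil_set n X) z \<and>
      set_power (Kiselman n) (Nil_set n X) ?c = {z})"
    using set_power_Nil_set_class[OF X] is_zero_of_Nil_set[OF X] by auto
next
  fix k
  assume k: "k \<ge> 1 \<and> (\<exists>z. is_zero_of (Kiselman n) (Nil_set n X) z \<and>
      set_power (Kiselman n) (Nil_set n X) k = {z})"
  then have pow: "set_power (Kiselman n) (Nil_set n X) k = {e_elem n X}"
    using is_zero_of_unique[OF is_zero_of_Nil_set[OF X]] by metis
  \<comment> \<open>The increasing word over \<open>X\<close> has content \<open>X\<close>, so its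
    k-fold repetition represents an element of the k-th power.\<close>
  let ?w = "concat (replicate k (sorted_list_of_set X))"
  have "kis_class n ?w \<in> set_power (Kiselman n) (Nil_set n X) k"
    unfolding set_power_Nil_set[OF X conjunct1[OF k]] using set_desc[OF X] by (intro imageI) simp
  then have "kis_class n ?w = kis_class n (desc X)"
    by (simp add: pow e_elem_conv[OF X])
  \<comment> \<open>Reflexivity puts \<open>desc X\<close> into its own class, which turns equality
    of classes back into congruence of words.\<close>
  moreover have "kis_cong n (desc X) (desc X)"
    using kis_cong_desc_absorb_left[OF X, of "[]"] by simp
  ultimately have "kis_cong n ?w (desc X)"
    by (metis mem_kis_class)
  then have "\<not> k < card X" using not_kis_cong_power_desc[OF X] by blast
  then show "?c \<le> k" using k by auto
qed

section \<open>Contents in nilpotent subsemigroups, and maximality\<close>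

lemma content_mult:
  assumes "x \<in> carrier (Kiselman n)" "y \<in> carrier (Kiselman n)"
  shows "content (x \<otimes>\<^bsub>Kiselman n\<^esub> y) = content x \<union> content y"
proof -
  obtain u v where uv: "u \<in> lists {1..n}" "v \<in> lists {1..n}"
      "x = kis_class n u" "y = kis_class n v"
    using assms unfolding carrier_Kiselman by blast
  then have "u @ v \<in> lists {1..n}" by simp
  with uv show ?thesis by (simp only: mult_kis_class content_kis_class set_append)
qed

lemma nilpotent_Nil_set:
  assumes X: "X \<subseteq> {1..n}"
  shows "nilpotent_subsemigroup (Kiselman n) (Nil_set n X)"
proof -
  have "x \<otimes>\<^bsub>Kiselman n\<^esub> y \<in> Nil_set n X" if "x \<in> Nil_set n X" "y \<in> Nil_set n X" for x y
    using that content_mult monoid.m_closed[OF monoid_Kiselman] unfolding Nil_set_def by auto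
  moreover have "Nil_set n X \<noteq> {}" "Nil_set n X \<subseteq> carrier (Kiselman n)"
    using is_zero_of_Nil_set[OF X] by (auto simp: is_zero_of_def Nil_set_def)
  moreover have "(if card X > 0 then card X else 1) \<ge> 1" by simp
  ultimately show ?thesis
    unfolding nilpotent_subsemigroup_def subsemigroup_def
    using is_zero_of_Nil_set[OF X] set_power_Nil_set_class[OF X] by blast
qed

text \<open>The witness is the k-th power of \<open>x\<close>: multiplying by \<open>x\<close> again
  leaves the content unchanged.\<close>

lemma set_power_content:
  assumes "S \<subseteq> carrier (Kiselman n)" "x \<in> S" "k \<ge> 1"
  shows "\<exists>y \<in> carrier (Kiselman n) \<inter> set_power (Kiselman n) S k. content y = content x"
  using assms(3)
proof (induction k rule: nat_induct_at_least)
  case base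
  then show ?case using assms by (auto simp: set_power_1)
next
  case (Suc k)
  then obtain y where y: "y \<in> carrier (Kiselman n)" "y \<in> set_power (Kiselman n) S k"
      "content y = content x"
    by blast
  have x: "x \<in> carrier (Kiselman n)" using assms by blast
  have "y \<otimes>\<^bsub>Kiselman n\<^esub> x \<in> set_power (Kiselman n) S (Suc k)"
    using Suc.hyps y(2) assms(2) by (auto simp: set_power_Suc set_mult_def)
  moreover have "y \<otimes>\<^bsub>Kiselman n\<^esub> x \<in> carrier (Kiselman n)"
    by (intro monoid.m_closed[OF monoid_Kiselman] x y)
  moreover have "content (y \<otimes>\<^bsub>Kiselman n\<^esub> x) = content x"
    using content_mult[OF y(1) x] y(3) by simp
  ultimately show ?case by blast
qed

text \<open>If the k-th power of \<open>S\<close> is {z}, then \<open>z\<close> is the k-th power of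
  every \<open>x\<close> in \<open>S\<close> and so shares its content. The set sought is therefore
  \<open>content z\<close>.\<close>

lemma nilpotent_subset_Nil_set:
  assumes "nilpotent_subsemigroup (Kiselman n) S"
  shows "\<exists>X. X \<subseteq> {1..n} \<and> S \<subseteq> Nil_set n X"
proof -
  have S: "S \<subseteq> carrier (Kiselman n)"
    using assms by (simp add: nilpotent_subsemigroup_def subsemigroup_def)
  obtain z k where z: "z \<in> S" and k: "k \<ge> 1" "set_power (Kiselman n) S k = {z}"
    using assms by (auto simp: nilpotent_subsemigroup_def is_zero_of_def)
  have "content x = content z" if "x \<in> S" for x
    using set_power_content[OF S that k(1)] k(2) by auto
  then have "S \<subseteq> Nil_set n (content z)" using S by (auto simp: Nil_set_def)
  moreover obtain w where "w \<in> lists {1..n}" "z = kis_class n w"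
    using z S unfolding carrier_Kiselman by blast
  then have "content z \<subseteq> {1..n}" using content_kis_class by blast
  ultimately show ?thesis by blast
qed

lemma maximal_nilpotent_Nil_set:
  assumes X: "X \<subseteq> {1..n}"
  shows "maximal_nilpotent_subsemigroup (Kiselman n) (Nil_set n X)"
  unfolding maximal_nilpotent_subsemigroup_def
proof (intro conjI allI impI)
  show "nilpotent_subsemigroup (Kiselman n) (Nil_set n X)" by (rule nilpotent_Nil_set[OF X])
  fix T
  assume T: "nilpotent_subsemigroup (Kiselman n) T \<and> Nil_set n X \<subseteq> T"
  then obtain Y where Y: "T \<subseteq> Nil_set n Y" using nilpotent_subset_Nil_set[of n T] by blast
  \<comment> \<open>This element lies in both \<open>Nil_set n X\<close> and
    \<open>Nil_set n Y\<close>, which forces the two contents to agree.\<close>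
  have "e_elem n X \<in> Nil_set n X"
    using is_zero_of_Nil_set[OF X] by (simp add: is_zero_of_def)
  with T Y have "X = Y" by (auto simp: Nil_set_def)
  with T Y show "T = Nil_set n X" by blast
qed

text \<open>Some \<open>Nil_set n X\<close> contains \<open>S\<close> and is itself nilpotent, so
  maximality of \<open>S\<close> forces equality.\<close>

lemma maximal_nilpotent_is_Nil_set:
  assumes "maximal_nilpotent_subsemigroup (Kiselman n) S"
  shows "\<exists>X. X \<subseteq> {1..n} \<and> S = Nil_set n X"
  using assms nilpotent_subset_Nil_set nilpotent_Nil_set
  unfolding maximal_nilpotent_subsemigroup_def by metis

lemma carrier_Kiselman_UN_Nil_set: "carrier (Kiselman n) = (\<Union>X\<in>Pow {1..n}. Nil_set n X)"
proof -
  have "content x \<subseteq> {1..n}" if "x \<in> carrier (Kiselman n)" for x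
    using that content_kis_class unfolding carrier_Kiselman by fastforce
  then show ?thesis by (auto simp: Nil_set_def)
qed

lemma disjoint_Nil_set: "disjoint_family_on (Nil_set n) A"
  by (auto simp: disjoint_family_on_def Nil_set_def)

theorem theorem25:
  fixes n :: nat
  assumes "n \<ge> 1"
  shows
    "(\<forall>X. X \<subseteq> {1..n} \<longrightarrow>
        maximal_nilpotent_subsemigroup (Kiselman n) (Nil_set n X) \<and>
        is_zero_of (Kiselman n) (Nil_set n X) (e_elem n X) \<and>
        nilpotency_class (Kiselman n) (Nil_set n X) = (if card X > 0 then card X else 1)) \<and>
     (\<forall>S. maximal_nilpotent_subsemigroup (Kiselman n) S \<longrightarrow>
        (\<exists>X. X \<subseteq> {1..n} \<and> S = Nil_set n X)) \<and>
     (carrier (Kiselman n) = (\<Union>X\<in>Pow {1..n}. Nil_set n X) \<and>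
        disjoint_family_on (Nil_set n) (Pow {1..n}))"
  using maximal_nilpotent_Nil_set is_zero_of_Nil_set nilpotency_class_Nil_set
    maximal_nilpotent_is_Nil_set carrier_Kiselman_UN_Nil_set disjoint_Nil_set
  by (intro conjI allI impI)

end
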